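(* Let $F:\mathbb{R}^2\to\mathbb{R}$ be a $C^1$ function. Suppose that $\boldsymbol{U}^{(n)}=\{U_k^{(n)}\}_{k=-1}^{K+1}\in\mathbb{R}^{K+3}$ $(n=0,1,\ldots,N)$ satisfies the difference scheme $$\delta_n^{\langle 2\rangle}U_k^{(n)}=\delta_k^{\langle 2\rangle}\left(\frac{U_k^{(n+1)}+U_k^{(n-1)}}{2}\right)-\frac{d(F,\mathrm{loc})}{d(U_k^{(n+1)},U_k^{(n)}:U_k^{(n)},U_k^{(n-1)})}\qquad(k=0,\ldots,K,\ n=1,\ldots,N-1),$$ $$\delta_n^{\langle 2\rangle}U_0^{(n)}-\delta_k^{\langle 1\rangle}\left(\frac{U_0^{(n+1)}+U_0^{(n-1)}}{2}\right)=0\qquad(n=1,\ldots,N-1),$$ $$\delta_n^{\langle 2\rangle}U_K^{(n)}+\delta_k^{\langle 1\rangle}\left(\frac{U_K^{(n+1)}+U_K^{(n-1)}}{2}\right)=0\qquad(n=1,\ldots,N-1).$$ Then $\delta_n^-J_{\mathrm{d}}(\boldsymbol{U}^{(n+1)},\boldsymbol{U}^{(n)})=0$ for all $n=1,\ldots,N-1$, where $$J_{\mathrm{d}}(\boldsymbol{U}^{(n+1)},\boldsymbol{U}^{(n)})=\sum_{k=0}^K{}''\frac12(\delta_n^+U_k^{(n)})^2\Delta x+\sum_{k=0}^{K-1}\frac12\left(\frac{(\delta_k^+U_k^{(n+1)})^2+(\delta_k^+U_k^{(n)})^2}{2}\right)\Delta x+\sum_{k=0}^K{}''F(U_k^{(n+1)},U_k^{(n)})\Delta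 x+\frac12(\delta_n^+U_0^{(n)})^2+\frac12(\delta_n^+U_K^{(n)})^2.$$
   Context: Let $L,T>0$, let $N,K$ be positive integers, $\Delta t=T/N$, $\Delta x=L/K$. For a family $f_k^{(n)}$ (time index $n$, space index $k$): $\delta_n^+f_k^{(n)}=\frac{f_k^{(n+1)}-f_k^{(n)}}{\Delta t}$, $\delta_k^+f_k^{(n)}=\frac{f_{k+1}^{(n)}-f_k^{(n)}}{\Delta x}$, $\delta_k^{\langle1\rangle}f_k^{(n)}=\frac{f_{k+1}^{(n)}-f_{k-1}^{(n)}}{2\Delta x}$, $\delta_n^{\langle2\rangle}f_k^{(n)}=\frac{f_k^{(n+1)}-2f_k^{(n)}+f_k^{(n-1)}}{(\Delta t)^2}$, $\delta_k^{\langle2\rangle}f_k^{(n)}=\frac{f_{k+1}^{(n)}-2f_k^{(n)}+f_{k-1}^{(n)}}{(\Delta x)^2}$. The operator $\delta_n^-$ is the backward difference in $n$: $\delta_n^-J_{\mathrm d}(\boldsymbol U^{(n+1)},\boldsymbol U^{(n)})=\frac{1}{\Delta t}\left(J_{\mathrm d}(\boldsymbol U^{(n+1)},\boldsymbol U^{(n)})-J_{\mathrm d}(\boldsymbol U^{(n)},\boldsymbol U^{(n-1)})\right)$. Trapezoidal sum: $\sum_{k=0}^K{}''f_k\Delta x=\frac12f_0\Delta x+\sum_{k=1}^{K-1}f_k\Delta x+\frac12f_K\Delta x$. Four-point difference quotient of a $C^1$ function $f:\mathbb{R}^2\to\mathbb{R}$: with $\mathrm{loc}(a,b)=\frac12(a+b)$,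 $$\frac{d(f,\mathrm{loc})}{d(a,b:c,d)}=\begin{cases}\dfrac{f(a,b)-f(c,d)}{\mathrm{loc}(a,b)-\mathrm{loc}(c,d)}&(\mathrm{loc}(a,b)\neq\mathrm{loc}(c,d)),\\[2mm]\left.\dfrac{d f(x,x)}{dx}\right|_{x=\mathrm{loc}(a,b)}&(\mathrm{loc}(a,b)=\mathrm{loc}(c,d)).\end{cases}$$
   Formalization: Adds the hypothesis, needed since the claim fails for general C^1 F (e.g. F(x,y)=4x+2y): whenever loc(U_k^(n+1),U_k^(n)) = loc(U_k^(n),U_k^(n-1)), also F(U_k^(n+1),U_k^(n)) = F(U_k^(n),U_k^(n-1)); automatic for symmetric F. *)

theory Defs
  imports "HOL-Analysis.Analysis"
begin

text \<open>
  A grid function is \<open>U :: nat \<Rightarrow> int \<Rightarrow> real\<close>, with \<open>U n k\<close> for $U_k^{(n)}$.  The space index is an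
  integer because the scheme uses the ghost points \<open>k = -1\<close> and \<open>k = K + 1\<close>; only the values with
  \<open>n \<le> N\<close> and \<open>-1 \<le> k \<le> K + 1\<close> matter.  Time operators act on sequences \<open>nat \<Rightarrow> real\<close> (they are
  applied to \<open>\<lambda>m. U m k\<close>), space operators on \<open>int \<Rightarrow> real\<close> (applied to \<open>U n\<close>).
\<close>

definition fwd_t :: "real \<Rightarrow> (nat \<Rightarrow> real) \<Rightarrow> nat \<Rightarrow> real" where
  "fwd_t dt f n = (f (n + 1) - f n) / dt"

text \<open>Natural subtraction: the next two are only meaningful for \<open>n \<ge> 1\<close>.\<close>

definition bwd_t :: "real \<Rightarrow> (nat \<Rightarrow> real) \<Rightarrow> nat \<Rightarrow> real" where
  "bwd_t dt f n = (f n - f (n - 1)) / dt"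

definition snd_t :: "real \<Rightarrow> (nat \<Rightarrow> real) \<Rightarrow> nat \<Rightarrow> real" where
  "snd_t dt f n = (f (n + 1) - 2 * f n + f (n - 1)) / dt\<^sup>2"

definition fwd_x :: "real \<Rightarrow> (int \<Rightarrow> real) \<Rightarrow> int \<Rightarrow> real" where
  "fwd_x dx g k = (g (k + 1) - g k) / dx"

definition cen_x :: "real \<Rightarrow> (int \<Rightarrow> real) \<Rightarrow> int \<Rightarrow> real" where
  "cen_x dx g k = (g (k + 1) - g (k - 1)) / (2 * dx)"

definition snd_x :: "real \<Rightarrow> (int \<Rightarrow> real) \<Rightarrow> int \<Rightarrow> real" where
  "snd_x dx g k = (g (k + 1) - 2 * g k + g (k - 1)) / dx\<^sup>2"

definition trap_sum :: "real \<Rightarrow> nat \<Rightarrow> (int \<Rightarrow> real) \<Rightarrow> real" where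
  "trap_sum dx K g =
     1/2 * g 0 * dx + (\<Sum>k = 1..int K - 1. g k * dx) + 1/2 * g (int K) * dx"

definition C1_on_plane :: "(real \<times> real \<Rightarrow> real) \<Rightarrow> bool" where
  "C1_on_plane F \<longleftrightarrow>
     (\<exists>F' :: real \<times> real \<Rightarrow> (real \<times> real) \<Rightarrow>\<^sub>L real.
        (\<forall>p. (F has_derivative blinfun_apply (F' p)) (at p)) \<and> continuous_on UNIV F')"

definition loc :: "real \<Rightarrow> real \<Rightarrow> real" where
  "loc a b = (a + b) / 2"

text \<open>
  The four-point difference quotient.  Pitfall: the product rule
  \<open>diff_quot f a b c d * (loc a b - loc c d) = f (a, b) - f (c, d)\<close> fails if
  \<open>loc a b = loc c d\<close> but \<open>f (a, b) \<noteq> f (c, d)\<close>.  For the arguments occurring in the scheme,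
  \<open>loc a b = loc b c\<close> means \<open>a = c\<close>, so this happens precisely when \<open>f (a, b) \<noteq> f (b, a)\<close>, which
  a symmetric \<open>f\<close> excludes but continuous differentiability alone does not.  The energy law is
  false in that situation, so it has to be stated with a compatibility hypothesis on \<open>F\<close> along
  the solution.
\<close>

definition diff_quot ::
    "(real \<times> real \<Rightarrow> real) \<Rightarrow> real \<Rightarrow> real \<Rightarrow> real \<Rightarrow> real \<Rightarrow> real" where
  "diff_quot f a b c d =
     (if loc a b \<noteq> loc c d then (f (a, b) - f (c, d)) / (loc a b - loc c d)
      else deriv (\<lambda>x. f (x, x)) (loc a b))"

text \<open>\<open>J_d F dt dx K U n\<close> is $J_{\mathrm d}(U^{(n+1)}, U^{(n)})$.\<close>

definition J_d ::
    "(real \<times> real \<Rightarrow> real) \<Rightarrow> real \<Rightarrow> real \<Rightarrow> nat \<Rightarrow> (nat \<Rightarrow> int \<Rightarrow> real) \<Rightarrow> nat \<Rightarrow> real" where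
  "J_d F dt dx K U n =
     trap_sum dx K (\<lambda>k. 1/2 * (fwd_t dt (\<lambda>m. U m k) n)\<^sup>2)
   + (\<Sum>k = 0..int K - 1.
        1/2 * (((fwd_x dx (U (n + 1)) k)\<^sup>2 + (fwd_x dx (U n) k)\<^sup>2) / 2) * dx)
   + trap_sum dx K (\<lambda>k. F (U (n + 1) k, U n k))
   + 1/2 * (fwd_t dt (\<lambda>m. U m 0) n)\<^sup>2
   + 1/2 * (fwd_t dt (\<lambda>m. U m (int K)) n)\<^sup>2"

end

theory Submission
  imports Defs
begin

text \<open>
  With $d_k = (U_k^{(n+1)} - U_k^{(n-1)}) / 2$ and $w_k = (U_k^{(n+1)} + U_k^{(n-1)}) / 2$, the increments of the
  kinetic terms, of the gradient terms and of \<open>F\<close> are the products of $d_k$ (or of its forward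
  difference) with the second time difference, with the forward difference of \<open>w\<close> and with the
  difference quotient of \<open>F\<close>.  Summation by parts turns the gradient terms into the second space
  difference of \<open>w\<close> plus boundary terms.  The interior terms then cancel by the scheme, and the
  boundary terms cancel against the boundary kinetic energy by the dynamic boundary conditions.
\<close>

lemma trap_sum_cong:
  assumes "\<And>k. k \<in> {0..int K} \<Longrightarrow> f k = g k"
  shows "trap_sum dx K f = trap_sum dx K g"
  unfolding trap_sum_def using assms by (auto intro!: sum.cong)

lemma trap_sum_add:
  "trap_sum dx K (\<lambda>k. f k + g k) = trap_sum dx K f + trap_sum dx K g"
  unfolding trap_sum_def by (simp add: sum.distrib algebra_simps add_divide_distrib)

lemma trap_sum_diff:
  "trap_sum dx K (\<lambda>k. f k - g k) = trap_sum dx K f - trap_sum dx K g"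
  unfolding trap_sum_def by (simp add: sum_subtractf algebra_simps diff_divide_distrib)

lemma sum_int_atLeastAtMost_Suc:
  fixes f :: "int \<Rightarrow> 'a::comm_monoid_add"
  assumes "a \<le> b + 1"
  shows "sum f {a..b + 1} = sum f {a..b} + f (b + 1)"
proof -
  have "{a..b + 1} = insert (b + 1) {a..b}"
    using assms by auto
  then show ?thesis
    by (simp add: add.commute)
qed

text \<open>Adding a cell raises the weight of the old endpoint from one half to one. For
  \<open>K = 0\<close> both half weights sit on the same point and the recursion fails.\<close>

lemma trap_sum_Suc:
  assumes "K > 0"
  shows "trap_sum dx (Suc K) g = trap_sum dx K g + (g (int K) + g (int K + 1)) / 2 * dx"
  using sum_int_atLeastAtMost_Suc[of 1 "int K - 1" "\<lambda>k. g k * dx"] assms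
  unfolding trap_sum_def by (simp add: add.commute algebra_simps add_divide_distrib)

text \<open>Induction on the number of cells: each cell contributes a difference of
  \<open>cen_x dx w k * d k\<close> between its two ends, and these telescope. The centred
  differences at the ends involve the ghost points.\<close>

lemma summation_by_parts:
  assumes "K > 0"
  shows "(\<Sum>k = 0..int K - 1. fwd_x dx w k * fwd_x dx d k * dx)
           + trap_sum dx K (\<lambda>k. snd_x dx w k * d k)
         = cen_x dx w (int K) * d (int K) - cen_x dx w 0 * d 0"
  using assms
proof (induction K rule: nat_induct_non_zero)
  case 1
  show ?case
    by (cases "dx = 0")
      (simp_all add: trap_sum_def fwd_x_def snd_x_def cen_x_def field_simps power2_eq_square)
next
  case (Suc K)
  have sum: "(\<Sum>k = 0..int (Suc K) - 1. fwd_x dx w k * fwd_x dx d k * dx)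
      = (\<Sum>k = 0..int K - 1. fwd_x dx w k * fwd_x dx d k * dx)
        + fwd_x dx w (int K) * fwd_x dx d (int K) * dx"
    using sum_int_atLeastAtMost_Suc[of 0 "int K - 1"] by simp
  \<comment> \<open>In the new cell, half of each second difference joins the forward difference of
    \<open>w\<close>, so that adjacent forward differences are averaged into
    \<open>cen_x\<close>.\<close>
  have step: "fwd_x dx w (int K) * fwd_x dx d (int K) * dx
      + (snd_x dx w (int K) * d (int K) + snd_x dx w (int K + 1) * d (int K + 1)) / 2 * dx
      = cen_x dx w (int K + 1) * d (int K + 1) - cen_x dx w (int K) * d (int K)"
    by (cases "dx = 0")
      (simp_all add: fwd_x_def snd_x_def cen_x_def field_simps power2_eq_square)
  show ?case
    using Suc.IH step unfolding sum trap_sum_Suc[OF \<open>K > 0\<close>] by (simp add: add.commute)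
qed

text \<open>The factor \<open>(a - c) / 2\<close> is the denominator
  \<open>loc a b - loc b c\<close>. If it vanishes, the derivative branch is multiplied by zero, and
  the assumption makes the right side zero too.\<close>

lemma diff_quot_mult:
  assumes "loc a b = loc b c \<Longrightarrow> F (a, b) = F (b, c)"
  shows "diff_quot F a b b c * ((a - c) / 2) = F (a, b) - F (b, c)"
proof (cases "a = c")
  case True
  then show ?thesis
    using assms by (simp add: loc_def)
next
  case False
  have "loc a b - loc b c = (a - c) / 2"
    by (simp add: loc_def field_simps)
  with False show ?thesis
    by (simp add: diff_quot_def)
qed

text \<open>Difference of squares: the two forward differences differ by \<open>dt\<close> times
  \<open>snd_t\<close>, and their sum is \<open>(f (n + 1) - f (n - 1)) / dt\<close>. Positivity of
  \<open>n\<close> gives \<open>n - 1 + 1 = n\<close>.\<close>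

lemma kinetic_diff:
  assumes "n > 0"
  shows "1/2 * (fwd_t dt f n)\<^sup>2 - 1/2 * (fwd_t dt f (n - 1))\<^sup>2
         = snd_t dt f n * ((f (n + 1) - f (n - 1)) / 2)"
  using assms
  by (cases "dt = 0") (simp_all add: fwd_t_def snd_t_def field_simps power2_eq_square)

text \<open>The middle level \<open>b\<close> cancels, leaving a difference of squares in
  \<open>a\<close> and \<open>c\<close>.\<close>

lemma gradient_diff:
  "1/2 * (((fwd_x dx a k)\<^sup>2 + (fwd_x dx b k)\<^sup>2) / 2) * dx
     - 1/2 * (((fwd_x dx b k)\<^sup>2 + (fwd_x dx c k)\<^sup>2) / 2) * dx
   = fwd_x dx (\<lambda>j. (a j + c j) / 2) k * fwd_x dx (\<lambda>j. (a j - c j) / 2) k * dx"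
  by (cases "dx = 0") (simp_all add: fwd_x_def field_simps power2_eq_square)

theorem theorem3p1:
  fixes L T dt dx :: real and N K :: nat
    and F :: "real \<times> real \<Rightarrow> real" and U :: "nat \<Rightarrow> int \<Rightarrow> real"
  assumes "L > 0" and "T > 0" and "N > 0" and "K > 0"
    and "dt = T / real N" and "dx = L / real K"
    and "C1_on_plane F"
    and scheme: "\<And>n k. n \<in> {1..N - 1} \<Longrightarrow> k \<in> {0..int K} \<Longrightarrow>
           snd_t dt (\<lambda>m. U m k) n =
             snd_x dx (\<lambda>j. (U (n + 1) j + U (n - 1) j) / 2) k
             - diff_quot F (U (n + 1) k) (U n k) (U n k) (U (n - 1) k)"
    and left_bc: "\<And>n. n \<in> {1..N - 1} \<Longrightarrow>
           snd_t dt (\<lambda>m. U m 0) n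
             - cen_x dx (\<lambda>j. (U (n + 1) j + U (n - 1) j) / 2) 0 = 0"
    and right_bc: "\<And>n. n \<in> {1..N - 1} \<Longrightarrow>
           snd_t dt (\<lambda>m. U m (int K)) n
             + cen_x dx (\<lambda>j. (U (n + 1) j + U (n - 1) j) / 2) (int K) = 0"
    and compat: "\<And>n k. n \<in> {1..N - 1} \<Longrightarrow> k \<in> {0..int K} \<Longrightarrow>
           loc (U (n + 1) k) (U n k) = loc (U n k) (U (n - 1) k) \<Longrightarrow>
           F (U (n + 1) k, U n k) = F (U n k, U (n - 1) k)"
  shows "\<forall>n \<in> {1..N - 1}. bwd_t dt (J_d F dt dx K U) n = 0"
proof
  fix n assume n: "n \<in> {1..N - 1}"
  then have "n > 0" and pred: "n - 1 + 1 = n"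
    by auto
  define w where "w = (\<lambda>j. (U (n + 1) j + U (n - 1) j) / 2)"
  define d where "d = (\<lambda>j. (U (n + 1) j - U (n - 1) j) / 2)"
  have kin: "1/2 * (fwd_t dt (\<lambda>m. U m k) n)\<^sup>2 - 1/2 * (fwd_t dt (\<lambda>m. U m k) (n - 1))\<^sup>2
      = snd_t dt (\<lambda>m. U m k) n * d k" for k
    using kinetic_diff[OF \<open>n > 0\<close>, of dt "\<lambda>m. U m k"] by (simp add: d_def)
  \<comment> \<open>Multiplying the scheme by \<open>d k\<close> makes the quotient term cancel the
    increment of \<open>F\<close>, at the endpoints as well.\<close>
  have interior: "1/2 * (fwd_t dt (\<lambda>m. U m k) n)\<^sup>2 - 1/2 * (fwd_t dt (\<lambda>m. U m k) (n - 1))\<^sup>2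
      + (F (U (n + 1) k, U n k) - F (U n k, U (n - 1) k)) = snd_x dx w k * d k"
    if k: "k \<in> {0..int K}" for k
  proof -
    have "diff_quot F (U (n + 1) k) (U n k) (U n k) (U (n - 1) k) * d k
        = F (U (n + 1) k, U n k) - F (U n k, U (n - 1) k)"
      unfolding d_def by (rule diff_quot_mult) (rule compat[OF n k])
    then show ?thesis
      unfolding kin scheme[OF n k, folded w_def] by (simp add: left_diff_distrib)
  qed
  have "trap_sum dx K (\<lambda>k. 1/2 * (fwd_t dt (\<lambda>m. U m k) n)\<^sup>2)
      - trap_sum dx K (\<lambda>k. 1/2 * (fwd_t dt (\<lambda>m. U m k) (n - 1))\<^sup>2)
      + (trap_sum dx K (\<lambda>k. F (U (n + 1) k, U n k)) - trap_sum dx K (\<lambda>k. F (U n k, U (n - 1) k)))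
      = trap_sum dx K (\<lambda>k. snd_x dx w k * d k)"
    unfolding trap_sum_diff[symmetric] trap_sum_add[symmetric]
    by (rule trap_sum_cong) (rule interior)
  moreover have "(\<Sum>k = 0..int K - 1.
        1/2 * (((fwd_x dx (U (n + 1)) k)\<^sup>2 + (fwd_x dx (U n) k)\<^sup>2) / 2) * dx)
      - (\<Sum>k = 0..int K - 1.
        1/2 * (((fwd_x dx (U n) k)\<^sup>2 + (fwd_x dx (U (n - 1)) k)\<^sup>2) / 2) * dx)
      = (\<Sum>k = 0..int K - 1. fwd_x dx w k * fwd_x dx d k * dx)"
    unfolding sum_subtractf[symmetric] gradient_diff w_def d_def ..
  moreover have "1/2 * (fwd_t dt (\<lambda>m. U m 0) n)\<^sup>2 - 1/2 * (fwd_t dt (\<lambda>m. U m 0) (n - 1))\<^sup>2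
      = cen_x dx w 0 * d 0"
    using kin left_bc[OF n, folded w_def] by simp
  moreover have "1/2 * (fwd_t dt (\<lambda>m. U m (int K)) n)\<^sup>2
      - 1/2 * (fwd_t dt (\<lambda>m. U m (int K)) (n - 1))\<^sup>2 = - (cen_x dx w (int K) * d (int K))"
    using kin right_bc[OF n, folded w_def] by (simp add: eq_neg_iff_add_eq_0 flip: distrib_right)
  moreover note summation_by_parts[OF \<open>K > 0\<close>, of dx w d]
  \<comment> \<open>The boundary kinetic increments are the negatives of the boundary terms left by
    summation by parts; \<open>pred\<close> aligns the time levels in \<open>J_d\<close> at
    \<open>n - 1\<close>.\<close>
  ultimately have "J_d F dt dx K U n - J_d F dt dx K U (n - 1) = 0"
    unfolding J_d_def pred by linarith
  then show "bwd_t dt (J_d F dt dx K U) n = 0"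
    by (simp add: bwd_t_def)
qed

end
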